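(* Let $p=p(n)$ satisfy $np\to\infty$ and $p\to 0$ as $n\to\infty$, and let $G_{n,p}$ denote the binomial random graph. (1) Given $1/2<c\le 1$, suppose $p=o(n^{-c})$. Then asymptotically almost surely, for every proper colouring of $G_{n,p}$ there is a rainbow independent set of size $\Omega(\chi(G_{n,p}))$. (2) Suppose $p=\omega(\sqrt{(\log n)/n})$. Then asymptotically almost surely, for every proper colouring of $G_{n,p}$ there is a rainbow independent set of size $\Omega(1/p)$.
   Context: $G_{n,p}$ is the random graph on $n$ vertices in which each pair of vertices is joined independently with probability $p$. A property holds asymptotically almost surely (a.a.s.) if its probability tends to $1$ as $n\to\infty$. $\chi$ denotes chromatic number. Given a proper colouring, a vertex set is rainbow if its vertices receive pairwise distinct colours. $\Omega(f)$ means at least a positive constant (independent of $n$) times $f$. *)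

theory Defs
  imports "HOL-Probability.Probability" "HOL-Library.Landau_Symbols"
begin

text \<open>A finite simple graph is given by a vertex set and a set of two-element edges.\<close>

definition pairs :: "'a set \<Rightarrow> 'a set set" where
  "pairs V = {e. e \<subseteq> V \<and> card e = 2}"

definition independent_set :: "'a set \<Rightarrow> 'a set set \<Rightarrow> 'a set \<Rightarrow> bool" where
  "independent_set V E S \<longleftrightarrow> S \<subseteq> V \<and> (\<forall>u\<in>S. \<forall>v\<in>S. {u, v} \<notin> E)"

text \<open>Colours are natural numbers; all graphs considered are finite, so this is no restriction.\<close>

definition proper_colouring :: "'a set \<Rightarrow> 'a set set \<Rightarrow> ('a \<Rightarrow> nat) \<Rightarrow> bool" where
  "proper_colouring V E col \<longleftrightarrow> (\<forall>u\<in>V. \<forall>v\<in>V. {u, v} \<in> E \<longrightarrow> col u \<noteq> col v)"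

definition chromatic_number :: "'a set \<Rightarrow> 'a set set \<Rightarrow> nat" where
  "chromatic_number V E = (LEAST k. \<exists>col. proper_colouring V E col \<and> col ` V \<subseteq> {..<k})"

definition rainbow :: "('a \<Rightarrow> nat) \<Rightarrow> 'a set \<Rightarrow> bool" where
  "rainbow col S \<longleftrightarrow> inj_on col S"

text \<open>The binomial random graph on the vertex set \<open>{..<n}\<close>, as a distribution on edge sets.
  It is meaningful for \<open>0 \<le> p \<le> 1\<close> only.\<close>

definition gnp :: "nat \<Rightarrow> real \<Rightarrow> nat set set pmf" where
  "gnp n p = map_pmf (\<lambda>f. {e \<in> pairs {..<n}. f e})
     (Pi_pmf (pairs {..<n}) False (\<lambda>_. bernoulli_pmf p))"

definition gnp_aas :: "(nat \<Rightarrow> real) \<Rightarrow> (nat \<Rightarrow> nat set set \<Rightarrow> bool) \<Rightarrow> bool" where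
  "gnp_aas p P \<longleftrightarrow>
     (\<lambda>n. measure_pmf.prob (gnp n (p n)) {E. P n E}) \<longlonglongrightarrow> 1"

end

theory Submission
  imports Defs "HOL-Real_Asymp.Real_Asymp"
begin

text \<open>
  Write \<open>d = np\<close> and \<open>L = ln d\<close>. If all degrees are at most \<open>K\<close> and all independent sets have at most
  \<open>s\<close> vertices, then a vertex conflicts with at most \<open>K + s\<close> vertices (its neighbours and its colour
  class), so picking conflict-free vertices greedily gives a rainbow independent set of size
  \<open>n / (K + s)\<close>. By first moment bounds one may take \<open>K\<close> and \<open>s\<close> of order \<open>d\<close> in the dense case,
  which gives \<open>\<Omega>(1 / p)\<close>. In the sparse case \<open>K\<close> is of order \<open>sqrt n\<close>, which is at most \<open>1 / p\<close>, and
  \<open>s\<close> is of order \<open>L / p\<close>, which gives \<open>\<Omega>(d / L)\<close>.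

  It remains to see that the chromatic number is \<open>O(d / L)\<close> in the sparse case. Colour the vertices
  by first fit with \<open>O(d / L)\<close> classes capped at \<open>L / (4p)\<close> vertices. At every step about \<open>4d / L\<close> classes
  are open, and each of them is free of neighbours of the new vertex with probability at least
  \<open>1 / sqrt d\<close>, independently. So a vertex stays uncoloured with probability at most
  \<open>exp (- 4 sqrt d / L)\<close>, and by Markov's inequality at most \<open>n / L\<close> vertices do. Sets of at most \<open>n / L\<close>
  vertices are so sparse that they are \<open>O(d / L)\<close>-degenerate, which colours the rest.
\<close>

subsection \<open>Random subsets of a finite set\<close>

definition random_subset :: "'a set \<Rightarrow> real \<Rightarrow> 'a set pmf" where
  "random_subset C p =
     map_pmf (\<lambda>f. {e \<in> C. f e}) (Pi_pmf C False (\<lambda>_. bernoulli_pmf p))"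

lemma gnp_random_subset: "gnp n p = random_subset (pairs {..<n}) p"
  by (simp add: gnp_def random_subset_def)

lemma set_random_subset: "E \<in> set_pmf (random_subset C p) \<Longrightarrow> E \<subseteq> C"
  by (auto simp: random_subset_def)

lemma random_subset_Un:
  assumes "finite A" "finite B" "A \<inter> B = {}"
  shows "random_subset (A \<union> B) p =
    map_pmf (\<lambda>(X, Y). X \<union> Y) (pair_pmf (random_subset A p) (random_subset B p))"
proof -
  have "random_subset (A \<union> B) p = map_pmf (\<lambda>(f, g). {e \<in> A. f e} \<union> {e \<in> B. g e})
    (pair_pmf (Pi_pmf A False (\<lambda>_. bernoulli_pmf p)) (Pi_pmf B False (\<lambda>_. bernoulli_pmf p)))"
    unfolding random_subset_def Pi_pmf_union[OF assms] map_pmf_comp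
    using assms(3) by (intro map_pmf_cong) auto
  then show ?thesis
    by (simp add: random_subset_def pair_map_pmf1 pair_map_pmf2 map_pmf_comp case_prod_unfold)
qed

lemma random_subset_marginal:
  assumes "finite C" "A \<subseteq> C"
  shows "map_pmf (\<lambda>E. E \<inter> A) (random_subset C p) = random_subset A p"
proof -
  have *: "random_subset (A \<union> (C - A)) p =
    map_pmf (\<lambda>(X, Y). X \<union> Y) (pair_pmf (random_subset A p) (random_subset (C - A) p))"
    using assms finite_subset by (intro random_subset_Un) auto
  have "map_pmf (\<lambda>E. E \<inter> A) (random_subset C p) =
      map_pmf fst (pair_pmf (random_subset A p) (random_subset (C - A) p))"
    using assms(2) * unfolding Un_Diff_cancel
    by (simp add: Un_absorb1 map_pmf_comp, intro map_pmf_cong)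
       (auto dest!: set_random_subset)
  then show ?thesis by (simp add: map_fst_pair_pmf)
qed

lemma prob_random_subset_cond:
  assumes C: "finite C" "A \<subseteq> C" and q0: "0 \<le> q"
    and q: "\<And>X. X \<subseteq> A \<Longrightarrow> P X \<Longrightarrow> measure_pmf.prob (random_subset (C - A) p) {Y. Q X Y} \<le> q"
  shows "measure_pmf.prob (random_subset C p) {E. P (E \<inter> A) \<and> Q (E \<inter> A) (E - A)}
    \<le> measure_pmf.prob (random_subset A p) {X. P X} * q"
proof -
  let ?M = "random_subset A p" and ?N = "random_subset (C - A) p"
  have *: "random_subset (A \<union> (C - A)) p = map_pmf (\<lambda>(X, Y). X \<union> Y) (pair_pmf ?M ?N)"
    using assms finite_subset by (intro random_subset_Un) auto
  have "measure_pmf.prob (random_subset C p) {E. P (E \<inter> A) \<and> Q (E \<inter> A) (E - A)}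
      = measure_pmf.prob (pair_pmf ?M ?N) ((\<lambda>(X, Y). X \<union> Y) -` {E. P (E \<inter> A) \<and> Q (E \<inter> A) (E - A)})"
    using C(2) * by (simp add: Un_absorb1)
  also have "\<dots> = measure_pmf.prob (pair_pmf ?M ?N) {(X, Y). P X \<and> Q X Y}"
  proof (rule measure_pmf.finite_measure_eq_AE)
    have "P ((X \<union> Y) \<inter> A) \<and> Q ((X \<union> Y) \<inter> A) (X \<union> Y - A) \<longleftrightarrow> P X \<and> Q X Y"
      if "X \<subseteq> A" "Y \<subseteq> C - A" for X Y
    proof -
      have "(X \<union> Y) \<inter> A = X" "X \<union> Y - A = Y" using that by auto
      then show ?thesis by simp
    qed
    then show "AE x in measure_pmf (pair_pmf ?M ?N).
      (x \<in> (\<lambda>(X, Y). X \<union> Y) -` {E. P (E \<inter> A) \<and> Q (E \<inter> A) (E - A)}) = (x \<in> {(X, Y). P X \<and> Q X Y})"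
      by (auto simp: AE_measure_pmf_iff dest!: set_random_subset)
  qed auto
  also have "\<dots> \<le> measure_pmf.prob ?M {X. P X} * q"
  proof -
    have le: "emeasure ?N {Y. P X \<and> Q X Y} \<le> indicator {X. P X} X * ennreal q" if "X \<subseteq> A" for X
      using q[OF that] by (cases "P X") (auto simp: measure_pmf.emeasure_eq_measure intro!: ennreal_leI)
    have "emeasure (pair_pmf ?M ?N) {(X, Y). P X \<and> Q X Y}
        = (\<integral>\<^sup>+X. emeasure ?N {Y. P X \<and> Q X Y} \<partial>?M)"
      unfolding pair_pmf_def
      by (simp only: emeasure_bind_pmf emeasure_return_pmf)
         (auto intro!: nn_integral_cong simp: nn_integral_indicator[symmetric] indicator_def
            simp del: nn_integral_indicator)
    also have "\<dots> \<le> (\<integral>\<^sup>+X. indicator {X. P X} X * ennreal q \<partial>?M)"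
      by (intro nn_integral_mono_AE) (use le in \<open>auto simp: AE_measure_pmf_iff dest!: set_random_subset\<close>)
    also have "\<dots> = emeasure ?M {X. P X} * ennreal q"
      by (simp add: nn_integral_multc)
    finally show ?thesis
      using q0 by (simp add: measure_pmf.emeasure_eq_measure flip: ennreal_mult)
  qed
  finally show ?thesis .
qed

lemma prob_random_subset_Pi:
  assumes "finite C" "F \<subseteq> C" 
  shows "measure_pmf.prob (random_subset C p) {E. \<forall>e\<in>F. e \<in> E \<longleftrightarrow> b}
    = measure_pmf.prob (bernoulli_pmf p) {b} ^ card F"
proof -
  have F: "finite F" using assms finite_subset by blast
  have "measure_pmf.prob (random_subset C p) {E. \<forall>e\<in>F. e \<in> E \<longleftrightarrow> b}
     = measure_pmf.prob (random_subset F p) {E. \<forall>e\<in>F. e \<in> E \<longleftrightarrow> b}"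
    unfolding random_subset_marginal[OF assms, symmetric] by (simp add: vimage_def)
  also have "\<dots> = measure_pmf.prob (Pi_pmf F False (\<lambda>_. bernoulli_pmf p)) (Pi F (\<lambda>_. {b}))"
    by (auto simp: random_subset_def vimage_def Pi_def intro!: arg_cong2[of _ _ _ _ "measure"])
  finally show ?thesis by (simp add: measure_Pi_pmf_Pi F)
qed

lemma prob_random_subset_superset:
  assumes "finite C" "F \<subseteq> C" "0 \<le> p" "p \<le> 1"
  shows "measure_pmf.prob (random_subset C p) {E. F \<subseteq> E} = p ^ card F"
  using prob_random_subset_Pi[OF assms(1,2), of p True] assms(3,4)
  by (simp add: subset_eq measure_pmf_single)

lemma prob_random_subset_disjoint:
  assumes "finite C" "F \<subseteq> C" "0 \<le> p" "p \<le> 1"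
  shows "measure_pmf.prob (random_subset C p) {E. E \<inter> F = {}} = (1 - p) ^ card F"
proof -
  have "{E. E \<inter> F = {}} = {E. \<forall>e\<in>F. e \<in> E \<longleftrightarrow> False}" by auto
  then show ?thesis using prob_random_subset_Pi[OF assms(1,2), of p False] assms(3,4)
    by (simp add: measure_pmf_single)
qed

lemma prob_random_subset_hit_all:
  assumes "finite I" "finite C" "disjoint_family_on B I" "0 \<le> p" "p \<le> 1"
    and "\<And>i. i \<in> I \<Longrightarrow> B i \<subseteq> C \<and> card (B i) \<le> k"
  shows "measure_pmf.prob (random_subset C p) {E. \<forall>i\<in>I. E \<inter> B i \<noteq> {}} \<le> (1 - (1 - p) ^ k) ^ card I"
  using assms
proof (induction I arbitrary: C rule: finite_induct)
  case (insert j I)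
  have B: "B i \<inter> B j = {}" if "i \<in> I" for i
    using insert.prems(2) insert.hyps that by (auto simp: disjoint_family_on_def)
  have BC: "B j \<subseteq> C" "card (B j) \<le> k" using insert.prems by auto
  have Bf: "finite (B j)" using BC insert.prems(1) finite_subset by blast
  have "{E. \<forall>i\<in>insert j I. E \<inter> B i \<noteq> {}}
      = {E. E \<inter> B j \<noteq> {} \<and> (\<forall>i\<in>I. (E - B j) \<inter> B i \<noteq> {})}"
    using B by fastforce
  also have "measure_pmf.prob (random_subset C p) \<dots>
    \<le> measure_pmf.prob (random_subset (B j) p) {E. E \<noteq> {}} * (1 - (1 - p) ^ k) ^ card I"
  proof (intro prob_random_subset_cond insert.IH)
    show "disjoint_family_on B I"
      using insert.prems(2) by (auto simp: disjoint_family_on_def)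
    show "B i \<subseteq> C - B j \<and> card (B i) \<le> k" if "i \<in> I" for i
      using insert.prems(5)[of i] B[OF that] that by auto
  qed (use BC insert.prems in \<open>auto simp: power_le_one\<close>)
  also have "measure_pmf.prob (random_subset (B j) p) {E. E \<noteq> {}}
      \<le> 1 - measure_pmf.prob (random_subset (B j) p) {E. E \<inter> B j = {}}"
  proof -
    have "measure_pmf.prob (random_subset (B j) p) {E. E \<noteq> {}}
       = measure_pmf.prob (random_subset (B j) p) (- {E. E \<inter> B j = {}})"
      by (rule measure_pmf.finite_measure_eq_AE)
         (auto simp: AE_measure_pmf_iff dest!: set_random_subset)
    also have "\<dots> = 1 - measure_pmf.prob (random_subset (B j) p) {E. E \<inter> B j = {}}"
      by (subst measure_pmf.prob_compl[symmetric]) (auto simp: Compl_eq_Diff_UNIV)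
    finally show ?thesis by simp
  qed
  also have "\<dots> = 1 - (1 - p) ^ card (B j)"
    using insert.prems Bf by (simp add: prob_random_subset_disjoint)
  also have "\<dots> \<le> 1 - (1 - p) ^ k"
    using power_decreasing[OF BC(2), of "1 - p"] insert.prems(3,4) by simp
  finally show ?case using insert.hyps insert.prems(3,4)
    by (simp add: mult_right_mono power_le_one)
qed (auto simp: power_le_one)

subsection \<open>Greedy arguments in graphs\<close>

lemma finite_pairs: "finite V \<Longrightarrow> finite (pairs V)"
  by (rule finite_subset[of _ "Pow V"]) (auto simp: pairs_def)

lemma card_pairs: "finite V \<Longrightarrow> card (pairs V) = card V choose 2"
  by (simp add: pairs_def n_subsets)

lemma pairs_mono: "A \<subseteq> B \<Longrightarrow> pairs A \<subseteq> pairs B"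
  by (auto simp: pairs_def)

lemma insert_in_pairs: "{u, v} \<in> pairs V \<longleftrightarrow> u \<in> V \<and> v \<in> V \<and> u \<noteq> v"
  by (auto simp: pairs_def card_insert_if)

lemma exists_conflict_free_subset:
  assumes "finite V" and "\<And>u v. R u v \<Longrightarrow> R v u"
    and "\<And>v. v \<in> V \<Longrightarrow> card (insert v {w \<in> V. R v w}) \<le> D"
  shows "\<exists>S \<subseteq> V. (\<forall>u\<in>S. \<forall>v\<in>S. u \<noteq> v \<longrightarrow> \<not> R u v) \<and> card V \<le> card S * D"
  using assms
proof (induction "card V" arbitrary: V rule: less_induct)
  case less
  show ?case
  proof (cases "V = {}")
    case False
    then obtain v where v: "v \<in> V" by auto
    let ?N = "insert v {w \<in> V. R v w}"
    have "card (V - ?N) < card V"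
      using less.prems(1) v by (intro psubset_card_mono) auto
    moreover have "card (insert u {w \<in> V - ?N. R u w}) \<le> D" if "u \<in> V - ?N" for u
      using less.prems(1) that
      by (intro order.trans[OF card_mono less.prems(3)[of u]]) auto
    ultimately have "\<exists>S \<subseteq> V - ?N. (\<forall>u\<in>S. \<forall>v\<in>S. u \<noteq> v \<longrightarrow> \<not> R u v) \<and> card (V - ?N) \<le> card S * D"
      using less.prems(1,2) by (intro less.hyps) blast+
    then obtain S where S: "S \<subseteq> V - ?N" "\<forall>u\<in>S. \<forall>v\<in>S. u \<noteq> v \<longrightarrow> \<not> R u v"
      "card (V - ?N) \<le> card S * D"
      by blast
    have "finite S" using S(1) less.prems(1) finite_subset by blast
    then have "card (insert v S) = Suc (card S)" using S(1) by (subst card_insert_disjoint) auto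
    moreover have "card V = card (V - ?N) + card ?N"
      using less.prems(1) v card_mono[of V ?N] by (subst card_Diff_subset) auto
    ultimately have "card V \<le> card (insert v S) * D" using S(3) less.prems(3)[OF v] by simp
    then show ?thesis
      using S(1,2) v less.prems(2) by (intro exI[of _ "insert v S"]) blast
  qed auto
qed

definition neighbours :: "'a set \<Rightarrow> 'a set set \<Rightarrow> 'a \<Rightarrow> 'a set" where
  "neighbours V E v = {w \<in> V. {v, w} \<in> E}"

lemma exists_rainbow_independent_set:
  assumes V: "finite V" and E: "E \<subseteq> pairs V" and col: "proper_colouring V E col"
    and deg: "\<And>v. v \<in> V \<Longrightarrow> card (neighbours V E v) \<le> K"
    and ind: "\<And>S. independent_set V E S \<Longrightarrow> card S \<le> s"
  shows "\<exists>S. independent_set V E S \<and> rainbow col S \<and> card V \<le> card S * (K + s)"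
proof -
  let ?R = "\<lambda>u v. {u, v} \<in> E \<or> col u = col v"
  have loop: "{v, v} \<notin> E" for v using E insert_in_pairs[of v v] by blast
  have "card (insert v {w \<in> V. ?R v w}) \<le> K + s" if "v \<in> V" for v
  proof -
    have "independent_set V E {w \<in> V. col v = col w}"
      using col by (force simp: independent_set_def proper_colouring_def)
    moreover have eq: "insert v {w \<in> V. ?R v w} = neighbours V E v \<union> {w \<in> V. col v = col w}"
      using that by (auto simp: neighbours_def)
    ultimately show ?thesis
      unfolding eq using deg[OF that] ind[of "{w \<in> V. col v = col w}"]
        card_Un_le[of "neighbours V E v" "{w \<in> V. col v = col w}"] by linarith
  qed
  then have "\<exists>S \<subseteq> V. (\<forall>u\<in>S. \<forall>v\<in>S. u \<noteq> v \<longrightarrow> \<not> ?R u v) \<and> card V \<le> card S * (K + s)"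
  proof (rule exists_conflict_free_subset[OF V, rotated])
    show "?R v u" if "?R u v" for u v
      using that by (metis insert_commute)
  qed
  then obtain S where S: "S \<subseteq> V" "\<forall>u\<in>S. \<forall>v\<in>S. u \<noteq> v \<longrightarrow> \<not> ?R u v"
    "card V \<le> card S * (K + s)"
    by blast
  have "{u, v} \<notin> E" if "u \<in> S" "v \<in> S" for u v
    using S(2) that loop by (cases "u = v") auto
  moreover have "inj_on col S" using S(2) by (auto simp: inj_on_def)
  ultimately show ?thesis using S(1,3) by (auto simp: independent_set_def rainbow_def)
qed

lemma sum_card_neighbours:
  assumes "finite W" "E \<subseteq> pairs V"
  shows "(\<Sum>v\<in>W. card (neighbours W E v)) = 2 * card {e \<in> E. e \<subseteq> W}"
proof -
  let ?E = "{e \<in> E. e \<subseteq> W}"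
  have fin: "finite ?E" by (rule finite_subset[of _ "Pow W"]) (use assms(1) in auto)
  have E2: "card e = 2" if "e \<in> E" for e using that assms(2) by (auto simp: pairs_def)
  have "card (neighbours W E v) = card {e \<in> ?E. v \<in> e}" if "v \<in> W" for v
  proof (rule bij_betw_same_card)
    have "inj_on (\<lambda>w. {v, w}) (neighbours W E v)"
      by (auto simp: inj_on_def doubleton_eq_iff)
    moreover have "(\<lambda>w. {v, w}) ` neighbours W E v = {e \<in> ?E. v \<in> e}"
    proof (intro equalityI subsetI)
      fix e assume e: "e \<in> {e \<in> ?E. v \<in> e}"
      then obtain x y where "e = {x, y}" using E2[of e] by (auto simp: card_2_iff)
      with e have "e = {v, if x = v then y else x}" by auto
      with e show "e \<in> (\<lambda>w. {v, w}) ` neighbours W E v"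
        unfolding neighbours_def image_iff by (intro bexI[of _ "if x = v then y else x"]) auto
    qed (use that in \<open>auto simp: neighbours_def\<close>)
    ultimately show "bij_betw (\<lambda>w. {v, w}) (neighbours W E v) {e \<in> ?E. v \<in> e}"
      by (auto simp: bij_betw_def)
  qed
  then have "(\<Sum>v\<in>W. card (neighbours W E v)) = (\<Sum>v\<in>W. card {e \<in> ?E. v \<in> e})" by simp
  also have "\<dots> = (\<Sum>e\<in>?E. card {v \<in> W. v \<in> e})"
    using sum.swap_restrict[OF assms(1) fin, of "\<lambda>_ _. 1::nat" "\<lambda>v e. v \<in> e"] by simp
  also have "\<dots> = (\<Sum>e\<in>?E. 2)"
  proof (rule sum.cong)
    fix e assume e: "e \<in> ?E"
    then have "{v \<in> W. v \<in> e} = e" by auto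
    then show "card {v \<in> W. v \<in> e} = 2" using e E2 by simp
  qed simp
  finally show ?thesis by simp
qed

lemma sparse_imp_colourable:
  assumes "finite W" "E \<subseteq> pairs V"
    and "\<And>S. S \<subseteq> W \<Longrightarrow> S \<noteq> {} \<Longrightarrow> card {e \<in> E. e \<subseteq> S} < r * card S"
  shows "\<exists>col. proper_colouring W E col \<and> col ` W \<subseteq> {..<2 * r}"
  using assms
proof (induction "card W" arbitrary: W rule: less_induct)
  case less
  show ?case
  proof (cases "W = {}")
    case False
    have "(\<Sum>v\<in>W. card (neighbours W E v)) < (\<Sum>v\<in>W. 2 * r)"
      using less.prems(3)[of W] False
      by (simp add: sum_card_neighbours[OF less.prems(1,2)] mult.commute)
    then obtain v where v: "v \<in> W" "card (neighbours W E v) < 2 * r"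
      by (meson not_less sum_mono)
    have "card {e \<in> E. e \<subseteq> S} < r * card S" if "S \<subseteq> W - {v}" "S \<noteq> {}" for S
      using less.prems(3)[of S] that by blast
    with less.hyps[of "W - {v}"] less.prems(1,2) card_Diff1_less[OF less.prems(1) v(1)]
    obtain col where col: "proper_colouring (W - {v}) E col" "col ` (W - {v}) \<subseteq> {..<2 * r}"
      by blast
    have "\<not> {..<2 * r} \<subseteq> col ` neighbours W E v"
    proof
      assume "{..<2 * r} \<subseteq> col ` neighbours W E v"
      then have "card {..<2 * r} \<le> card (col ` neighbours W E v)"
        using less.prems(1) by (intro card_mono) (auto simp: neighbours_def)
      also have "\<dots> \<le> card (neighbours W E v)"
        using less.prems(1) by (intro card_image_le) (auto simp: neighbours_def)
      finally show False using v(2) by simp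
    qed
    then obtain i where i: "i < 2 * r" "i \<notin> col ` neighbours W E v" by auto
    have loop: "{v} \<notin> E" using less.prems(2) insert_in_pairs[of v v] by auto
    have i': "col w \<noteq> i" if "w \<in> W" "{v, w} \<in> E" for w
      using i(2) that by (auto simp: neighbours_def)
    have "proper_colouring W E (col(v := i))"
      using col(1) i' loop unfolding proper_colouring_def by (auto simp: insert_commute)
    moreover have "(col(v := i)) ` W \<subseteq> {..<2 * r}" using col(2) i(1) by auto
    ultimately show ?thesis by blast
  qed (auto simp: proper_colouring_def)
qed

lemma chromatic_number_le_sum:
  assumes "proper_colouring (V - F) E c1" "c1 ` (V - F) \<subseteq> {..<m}"
    and "proper_colouring F E c2" "c2 ` F \<subseteq> {..<l}"
  shows "chromatic_number V E \<le> m + l"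
  unfolding chromatic_number_def
proof (intro Least_le exI[of _ "\<lambda>v. if v \<in> F then m + c2 v else c1 v"] conjI)
  have "c1 v < m" if "v \<in> V" "v \<notin> F" for v using that assms(2) by auto
  then have "m + i \<noteq> c1 v" "c1 v \<noteq> m + i" if "v \<in> V" "v \<notin> F" for v i
    using that by (metis not_add_less1)+
  then show "proper_colouring V E (\<lambda>v. if v \<in> F then m + c2 v else c1 v)"
    using assms(1,3) unfolding proper_colouring_def by simp
  show "(\<lambda>v. if v \<in> F then m + c2 v else c1 v) ` V \<subseteq> {..<m + l}"
    using assms(2,4) by (auto simp: image_subset_iff intro: trans_less_add1)
qed

subsection \<open>First fit with capped classes\<close>

definition admissible :: "nat \<Rightarrow> nat set set \<Rightarrow> (nat \<Rightarrow> nat) \<Rightarrow> nat \<Rightarrow> nat \<Rightarrow> bool" where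
  "admissible k E c v i \<longleftrightarrow> card {u. u < v \<and> c u = i} < k \<and> (\<forall>u<v. c u = i \<longrightarrow> {u, v} \<notin> E)"

text \<open>The colour \<open>m\<close> marks the vertices for which none of the classes \<open>0, \<dots>, m - 1\<close>, which are
  capped at \<open>k\<close> vertices each, is available.\<close>

primrec first_fit :: "nat \<Rightarrow> nat \<Rightarrow> nat set set \<Rightarrow> nat \<Rightarrow> nat \<Rightarrow> nat" where
  "first_fit m k E 0 = (\<lambda>_. m)"
| "first_fit m k E (Suc v) = (first_fit m k E v)
     (v := (LEAST i. i = m \<or> admissible k E (first_fit m k E v) v i))"

lemma first_fit_prefix: "u < v \<Longrightarrow> v \<le> w \<Longrightarrow> first_fit m k E w u = first_fit m k E v u"
  by (induction w) (auto simp: le_Suc_eq)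

lemma first_fit_new_le: "first_fit m k E (Suc v) v \<le> m"
  by (simp add: Least_le)

lemma first_fit_new_admissible:
  assumes "first_fit m k E (Suc v) v \<noteq> m"
  shows "admissible k E (first_fit m k E v) v (first_fit m k E (Suc v) v)"
  using LeastI[of "\<lambda>i. i = m \<or> admissible k E (first_fit m k E v) v i" m] assms by simp

lemma first_fit_new_fail:
  assumes "first_fit m k E (Suc v) v = m" "i < m"
  shows "\<not> admissible k E (first_fit m k E v) v i"
  using not_less_Least[of i "\<lambda>i. i = m \<or> admissible k E (first_fit m k E v) v i"] assms by simp

lemma first_fit_cong:
  assumes "E \<inter> pairs {..<v} = E' \<inter> pairs {..<v}"
  shows "first_fit m k E v = first_fit m k E' v"
  using assms
proof (induction v)
  case (Suc v)
  have "pairs {..<v} \<subseteq> pairs {..<Suc v}" by (intro pairs_mono) auto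
  then have IH: "first_fit m k E v = first_fit m k E' v" using Suc by blast
  have "{u, v} \<in> E \<longleftrightarrow> {u, v} \<in> E'" if "u < v" for u
  proof -
    have "{u, v} \<in> pairs {..<Suc v}" using that by (simp add: insert_in_pairs)
    then show ?thesis using Suc.prems by blast
  qed
  then have "admissible k E c v i \<longleftrightarrow> admissible k E' c v i" for c i
    by (auto simp: admissible_def)
  then show ?case using IH by simp
qed simp

lemma first_fit_proper:
  assumes "E \<subseteq> pairs {..<n}"
  shows "proper_colouring ({..<n} - {v \<in> {..<n}. first_fit m k E n v = m}) E (first_fit m k E n)"
  (is "proper_colouring (_ - ?F) E ?c")
proof -
  have ne: "?c u \<noteq> ?c v" if "u < v" "v < n" "?c v \<noteq> m" "{u, v} \<in> E" for u v
  proof -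
    have v: "first_fit m k E (Suc v) v = ?c v" using first_fit_prefix[of v "Suc v" n m k E] that by simp
    have u: "first_fit m k E v u = ?c u" using first_fit_prefix[of u v n m k E] that by simp
    show ?thesis using first_fit_new_admissible[of m k E v] that u unfolding v
      by (auto simp: admissible_def)
  qed
  have "?c u \<noteq> ?c v" if "u \<noteq> v" "u < n" "v < n" "?c v \<noteq> m" "?c u \<noteq> m" "{u, v} \<in> E" for u v
    using ne[of u v] ne[of v u] that by (cases "u < v") (auto simp: insert_commute)
  moreover have "{u} \<notin> E" for u using assms insert_in_pairs[of u u] by auto
  ultimately have "{u, v} \<in> E \<longrightarrow> ?c u \<noteq> ?c v"
    if "u < n" "v < n" "?c v \<noteq> m" "?c u \<noteq> m" for u v
    using that by (cases "u = v") auto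
  then show ?thesis by (simp add: proper_colouring_def)
qed

lemma first_fit_le: "v < n \<Longrightarrow> first_fit m k E n v \<le> m"
  using first_fit_prefix[of v "Suc v" n m k E] first_fit_new_le[of m k E v] by simp

text \<open>At most \<open>h\<close> classes can be full, so \<open>l\<close> of the \<open>l + h\<close> classes are always open; they are
  disjoint, so the edges from the new vertex to them are independent of each other and of the
  graph seen so far.\<close>

lemma card_open_classes:
  assumes "v \<le> n" "n \<le> k * h" "0 < k"
  shows "l \<le> card {i. i < l + h \<and> card {u. u < v \<and> c u = i} < k}"
proof -
  let ?cl = "\<lambda>i. {u. u < v \<and> c u = i}"
  let ?O = "{i. i < l + h \<and> card (?cl i) < k}" and ?C = "{i. i < l + h \<and> k \<le> card (?cl i)}"
  have "card ?C * k \<le> (\<Sum>i\<in>?C. card (?cl i))" using sum_bounded_below[of ?C k "\<lambda>i. card (?cl i)"] by simp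
  also have "\<dots> = card (\<Union>i\<in>?C. ?cl i)" by (subst card_UN_disjoint) auto
  also have "\<dots> \<le> card {..<v}" by (intro card_mono) auto
  finally have "card ?C * k \<le> v" by simp
  also have "v \<le> h * k" using assms by (simp add: mult.commute)
  finally have "card ?C \<le> h" using assms(3) by (simp only: mult_le_cancel2)
  moreover have "card ?O + card ?C = card (?O \<union> ?C)" by (subst card_Un_disjoint) auto
  moreover have "?O \<union> ?C = {..<l + h}" by auto
  ultimately show ?thesis by simp
qed

lemma prob_first_fit_fail:
  assumes p: "0 \<le> p" "p \<le> 1" and v: "v < n" and k: "0 < k" "n \<le> k * h"
  shows "measure_pmf.prob (gnp n p) {E. first_fit (l + h) k E n v = l + h} \<le> (1 - (1 - p) ^ k) ^ l"
proof -
  let ?c = "\<lambda>X. first_fit (l + h) k X v"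
  define O' where "O' = (\<lambda>X. {i. i < l + h \<and> card {u. u < v \<and> ?c X u = i} < k})"
  define B where "B = (\<lambda>X i. (\<lambda>u. {u, v}) ` {u. u < v \<and> ?c X u = i})"
  let ?A = "pairs {..<v}"
  have AC: "?A \<subseteq> pairs {..<n}" using v by (intro pairs_mono) auto
  have notA: "{u, v} \<notin> ?A" for u by (simp add: insert_in_pairs)
  have "measure_pmf.prob (gnp n p) {E. first_fit (l + h) k E n v = l + h}
     \<le> measure_pmf.prob (gnp n p) {E. True \<and> (\<forall>i\<in>O' (E \<inter> ?A). (E - ?A) \<inter> B (E \<inter> ?A) i \<noteq> {})}"
  proof (rule measure_pmf.finite_measure_mono)
    show "{E. first_fit (l + h) k E n v = l + h}
      \<subseteq> {E. True \<and> (\<forall>i\<in>O' (E \<inter> ?A). (E - ?A) \<inter> B (E \<inter> ?A) i \<noteq> {})}"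
    proof safe
      fix E i assume E: "first_fit (l + h) k E n v = l + h" and i: "i \<in> O' (E \<inter> ?A)"
        and empty: "(E - ?A) \<inter> B (E \<inter> ?A) i = {}"
      have c: "?c (E \<inter> ?A) = ?c E" by (rule first_fit_cong) auto
      have "first_fit (l + h) k E (Suc v) v = l + h"
        using E first_fit_prefix[of v "Suc v" n "l + h" k E] v by simp
      then have "\<not> admissible k E (?c E) v i"
        using i by (intro first_fit_new_fail) (auto simp: O'_def)
      then obtain u where "u < v" "?c E u = i" "{u, v} \<in> E"
        using i unfolding admissible_def O'_def c by auto
      then have "{u, v} \<in> (E - ?A) \<inter> B (E \<inter> ?A) i"
        using notA unfolding B_def c by auto
      with empty show False by blast
    qed
  qed simp
  also have "\<dots> \<le> measure_pmf.prob (random_subset ?A p) {X. True} * (1 - (1 - p) ^ k) ^ l"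
    unfolding gnp_random_subset
  proof (rule prob_random_subset_cond)
    fix X
    have "measure_pmf.prob (random_subset (pairs {..<n} - ?A) p) {Y. \<forall>i\<in>O' X. Y \<inter> B X i \<noteq> {}}
      \<le> (1 - (1 - p) ^ k) ^ card (O' X)"
    proof (rule prob_random_subset_hit_all)
      show "disjoint_family_on (B X) (O' X)"
        by (auto simp: disjoint_family_on_def B_def doubleton_eq_iff)
      show "B X i \<subseteq> pairs {..<n} - ?A \<and> card (B X i) \<le> k" if "i \<in> O' X" for i
      proof
        show "B X i \<subseteq> pairs {..<n} - ?A"
          using v notA by (auto simp: B_def insert_in_pairs)
        have "card (B X i) \<le> card {u. u < v \<and> ?c X u = i}"
          unfolding B_def by (intro card_image_le) auto
        then show "card (B X i) \<le> k" using that by (auto simp: O'_def)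
      qed
    qed (use p in \<open>auto simp: finite_pairs O'_def\<close>)
    also have "\<dots> \<le> (1 - (1 - p) ^ k) ^ l"
      using card_open_classes[of v n k h l "?c X"] v k p
      by (intro power_decreasing) (auto simp: O'_def power_le_one)
    finally show "measure_pmf.prob (random_subset (pairs {..<n} - ?A) p) {Y. \<forall>i\<in>O' X. Y \<inter> B X i \<noteq> {}}
      \<le> (1 - (1 - p) ^ k) ^ l" .
  qed (use AC p in \<open>auto simp: finite_pairs power_le_one\<close>)
  finally show ?thesis by simp
qed

lemma prob_card_ge_le:
  fixes M :: "'a pmf"
  assumes "finite I" "0 < a" "\<And>i. i \<in> I \<Longrightarrow> measure_pmf.prob M {x. P i x} \<le> q"
  shows "measure_pmf.prob M {x. a \<le> real (card {i \<in> I. P i x})} \<le> real (card I) * q / a"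
proof -
  have card: "real (card {i \<in> I. P i x}) = (\<Sum>i\<in>I. indicator {x. P i x} x)" for x
    using assms(1) by (simp add: indicator_def sum.If_cases Int_def)
  have int: "integrable (measure_pmf M) (indicator {x. P i x} :: _ \<Rightarrow> real)" for i
    by (rule measure_pmf.integrable_const_bound[of _ 1]) auto
  have "a * measure_pmf.prob M {x. a \<le> real (card {i \<in> I. P i x})}
      \<le> measure_pmf.expectation M (\<lambda>x. real (card {i \<in> I. P i x}))"
    unfolding card using integral_Markov_inequality_measure[of "measure_pmf M" "\<lambda>x. \<Sum>i\<in>I. indicator {x. P i x} x" "{}" a] assms(2) int
    by (simp add: sum_nonneg field_simps)
  also have "\<dots> = (\<Sum>i\<in>I. measure_pmf.prob M {x. P i x})"
    unfolding card using int by simp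
  also have "\<dots> \<le> real (card I) * q" using assms(3) by (intro sum_bounded_above) auto
  finally show ?thesis using assms(2) by (simp add: field_simps)
qed

subsection \<open>First moment bounds\<close>

lemma gnp_mono:
  assumes "\<And>E. E \<subseteq> pairs {..<n} \<Longrightarrow> P E \<Longrightarrow> Q E"
  shows "measure_pmf.prob (gnp n p) {E. P E} \<le> measure_pmf.prob (gnp n p) {E. Q E}"
  using assms unfolding gnp_random_subset
  by (intro measure_pmf.finite_measure_mono_AE)
     (auto simp: AE_measure_pmf_iff dest!: set_random_subset)

lemma prob_Ex_le:
  fixes M :: "'a pmf"
  assumes "finite I" "\<And>i. i \<in> I \<Longrightarrow> measure_pmf.prob M {x. P i x} \<le> q"
  shows "measure_pmf.prob M {x. \<exists>i\<in>I. P i x} \<le> real (card I) * q"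
proof -
  have "measure_pmf.prob M (\<Union>i\<in>I. {x. P i x}) \<le> (\<Sum>i\<in>I. measure_pmf.prob M {x. P i x})"
    using assms(1) by (intro measure_pmf.finite_measure_subadditive_finite) auto
  also have "\<dots> \<le> real (card I) * q" using assms(2) by (intro sum_bounded_above) auto
  moreover have "{x. \<exists>i\<in>I. P i x} = (\<Union>i\<in>I. {x. P i x})" by auto
  ultimately show ?thesis by simp
qed

lemma prob_gnp_superset:
  assumes "F \<subseteq> pairs {..<n}" "0 \<le> p" "p \<le> 1"
  shows "measure_pmf.prob (gnp n p) {E. F \<subseteq> E} = p ^ card F"
  using assms by (simp add: gnp_random_subset prob_random_subset_superset finite_pairs)

lemma prob_high_degree:
  assumes p: "0 \<le> p" "p \<le> 1"
  shows "measure_pmf.prob (gnp n p) {E. \<exists>v<n. K \<le> card (neighbours {..<n} E v)}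
    \<le> real n * (real (n choose K) * p ^ K)"
proof -
  let ?T = "\<lambda>v. {S. S \<subseteq> {..<n} - {v} \<and> card S = K}"
  have fin: "finite (?T v)" for v by (rule finite_subset[of _ "Pow {..<n}"]) auto
  have "measure_pmf.prob (gnp n p) {E. \<exists>v<n. K \<le> card (neighbours {..<n} E v)}
    \<le> measure_pmf.prob (gnp n p) {E. \<exists>v\<in>{..<n}. \<exists>S\<in>?T v. (\<lambda>w. {v, w}) ` S \<subseteq> E}"
  proof (rule gnp_mono)
    fix E assume E: "E \<subseteq> pairs {..<n}" and "\<exists>v<n. K \<le> card (neighbours {..<n} E v)"
    then obtain v where v: "v < n" "K \<le> card (neighbours {..<n} E v)" by auto
    from v(2) obtain S where S: "S \<subseteq> neighbours {..<n} E v" "card S = K"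
      by (rule obtain_subset_with_card_n)
    have "{v, v} \<notin> E" using E insert_in_pairs[of v v] by blast
    then have "S \<in> ?T v" "(\<lambda>w. {v, w}) ` S \<subseteq> E" using S by (auto simp: neighbours_def)
    then show "\<exists>v\<in>{..<n}. \<exists>S\<in>?T v. (\<lambda>w. {v, w}) ` S \<subseteq> E"
      using v(1) by (meson lessThan_iff)
  qed
  also have "\<dots> \<le> real (card {..<n}) * (real (n choose K) * p ^ K)"
  proof (rule prob_Ex_le)
    fix v assume v: "v \<in> {..<n}"
    have "measure_pmf.prob (gnp n p) {E. \<exists>S\<in>?T v. (\<lambda>w. {v, w}) ` S \<subseteq> E} \<le> real (card (?T v)) * p ^ K"
    proof (rule prob_Ex_le[OF fin])
      fix S assume S: "S \<in> ?T v"
      have "card ((\<lambda>w. {v, w}) ` S) = K"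
        using S by (subst card_image) (auto simp: inj_on_def doubleton_eq_iff)
      moreover have "(\<lambda>w. {v, w}) ` S \<subseteq> pairs {..<n}"
        using S v by (auto simp: insert_in_pairs)
      ultimately show "measure_pmf.prob (gnp n p) {E. (\<lambda>w. {v, w}) ` S \<subseteq> E} \<le> p ^ K"
        using p by (simp add: prob_gnp_superset)
    qed
    also have "real (card (?T v)) * p ^ K \<le> real (n choose K) * p ^ K"
    proof (rule mult_right_mono)
      have "card (?T v) \<le> card {S. S \<subseteq> {..<n} \<and> card S = K}"
      by (rule card_mono[OF finite_subset[of _ "Pow {..<n}"]]) auto
      then show "real (card (?T v)) \<le> real (n choose K)" by (simp add: n_subsets)
    qed (use p in simp)
    finally show "measure_pmf.prob (gnp n p) {E. \<exists>S\<in>?T v. (\<lambda>w. {v, w}) ` S \<subseteq> E}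
      \<le> real (n choose K) * p ^ K" .
  qed auto
  finally show ?thesis by simp
qed

lemma prob_large_independent_set:
  assumes p: "0 \<le> p" "p \<le> 1"
  shows "measure_pmf.prob (gnp n p) {E. \<exists>S. independent_set {..<n} E S \<and> s \<le> card S}
    \<le> real (n choose s) * (1 - p) ^ (s choose 2)"
proof -
  let ?T = "{S. S \<subseteq> {..<n} \<and> card S = s}"
  have "measure_pmf.prob (gnp n p) {E. \<exists>S. independent_set {..<n} E S \<and> s \<le> card S}
    \<le> measure_pmf.prob (gnp n p) {E. \<exists>S\<in>?T. E \<inter> pairs S = {}}"
  proof (rule gnp_mono)
    fix E assume "\<exists>S. independent_set {..<n} E S \<and> s \<le> card S"
    then obtain S where S: "independent_set {..<n} E S" "s \<le> card S" by auto
    from S(2) obtain T where T: "T \<subseteq> S" "card T = s" by (rule obtain_subset_with_card_n)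
    have "E \<inter> pairs T = {}"
      using S(1) T(1) by (fastforce simp: independent_set_def pairs_def card_2_iff)
    then show "\<exists>S\<in>?T. E \<inter> pairs S = {}"
      using S(1) T by (intro bexI[of _ T]) (auto simp: independent_set_def)
  qed
  also have "\<dots> \<le> real (card ?T) * (1 - p) ^ (s choose 2)"
  proof (rule prob_Ex_le)
    show "finite ?T" by (rule finite_subset[of _ "Pow {..<n}"]) auto
    fix S assume S: "S \<in> ?T"
    then have "finite S" using finite_subset by blast
    then have "card (pairs S) = s choose 2" using S card_pairs by auto
    then show "measure_pmf.prob (gnp n p) {E. E \<inter> pairs S = {}} \<le> (1 - p) ^ (s choose 2)"
      using prob_random_subset_disjoint[OF finite_pairs pairs_mono, of "{..<n}" S p] S p
      by (auto simp: gnp_random_subset)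
  qed
  finally show ?thesis by (simp add: n_subsets)
qed

lemma prob_dense_subset:
  assumes p: "0 \<le> p" "p \<le> 1"
  shows "measure_pmf.prob (gnp n p) {E. \<exists>S. S \<subseteq> {..<n} \<and> card S = s \<and> a \<le> card {e \<in> E. e \<subseteq> S}}
    \<le> real (n choose s) * (real ((s choose 2) choose a) * p ^ a)"
proof -
  let ?T = "{S. S \<subseteq> {..<n} \<and> card S = s}" and ?F = "\<lambda>S. {F. F \<subseteq> pairs S \<and> card F = a}"
  have finT: "finite ?T" by (rule finite_subset[of _ "Pow {..<n}"]) auto
  have finS: "finite S" if "S \<in> ?T" for S using that finite_subset by blast
  have "measure_pmf.prob (gnp n p) {E. \<exists>S. S \<subseteq> {..<n} \<and> card S = s \<and> a \<le> card {e \<in> E. e \<subseteq> S}}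
    \<le> measure_pmf.prob (gnp n p) {E. \<exists>S\<in>?T. \<exists>F\<in>?F S. F \<subseteq> E}"
  proof (rule gnp_mono)
    fix E assume E: "E \<subseteq> pairs {..<n}"
      and "\<exists>S. S \<subseteq> {..<n} \<and> card S = s \<and> a \<le> card {e \<in> E. e \<subseteq> S}"
    then obtain S where S: "S \<subseteq> {..<n}" "card S = s" "a \<le> card {e \<in> E. e \<subseteq> S}" by auto
    from S(3) obtain F where F: "F \<subseteq> {e \<in> E. e \<subseteq> S}" "card F = a"
      by (rule obtain_subset_with_card_n)
    have "F \<subseteq> pairs S" using F(1) E by (auto simp: pairs_def)
    then show "\<exists>S\<in>?T. \<exists>F\<in>?F S. F \<subseteq> E"
    proof (intro bexI)
      show "F \<subseteq> E" using F(1) by blast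
    qed (use S F in simp_all)
  qed
  also have "\<dots> \<le> real (card ?T) * (real ((s choose 2) choose a) * p ^ a)"
  proof (rule prob_Ex_le[OF finT])
    fix S assume S: "S \<in> ?T"
    have fin: "finite (pairs S)" using finS[OF S] by (rule finite_pairs)
    have "measure_pmf.prob (gnp n p) {E. \<exists>F\<in>?F S. F \<subseteq> E} \<le> real (card (?F S)) * p ^ a"
    proof (rule prob_Ex_le)
      show "finite (?F S)" by (rule finite_subset[of _ "Pow (pairs S)"]) (use fin in auto)
      show "measure_pmf.prob (gnp n p) {E. F \<subseteq> E} \<le> p ^ a" if "F \<in> ?F S" for F
        using that S p pairs_mono[of S "{..<n}"] by (subst prob_gnp_superset) auto
    qed
    moreover have "card (?F S) = (s choose 2) choose a"
      using fin S finS[OF S] by (simp add: n_subsets card_pairs)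
    ultimately show "measure_pmf.prob (gnp n p) {E. \<exists>F\<in>?F S. F \<subseteq> E} \<le> real ((s choose 2) choose a) * p ^ a" by simp
  qed
  finally show ?thesis by (simp add: n_subsets)
qed

lemma binomial_le_exp_power: "real (N choose k) \<le> (exp 1 * real N / real k) ^ k"
proof (cases "k = 0")
  case False
  have "(\<Sum>i\<in>{k}. real k ^ i / fact i) \<le> exp (real k)"
    unfolding exp_def using summable_exp_generic[of "real k"]
    by (intro sum_le_suminf[THEN order.trans]) (auto simp: field_simps scaleR_conv_of_real)
  then have "real k ^ k \<le> exp 1 ^ k * fact k" by (simp add: field_simps exp_of_nat_mult[symmetric])
  moreover have "real (N choose k) * fact k \<le> real N ^ k"
    using binomial_fact_pow[of N k] by (metis of_nat_fact of_nat_le_iff of_nat_mult of_nat_power)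
  ultimately have "real (N choose k) * fact k * real k ^ k \<le> real N ^ k * (exp 1 ^ k * fact k)"
    by (intro mult_mono) auto
  then have "real (N choose k) * real k ^ k \<le> real N ^ k * exp 1 ^ k" by simp
  then show ?thesis using False by (simp add: power_divide power_mult_distrib field_simps)
qed simp

lemma real_choose_two: "real (s choose 2) = real s * (real s - 1) / 2"
  by (induction s) (auto simp: numeral_2_eq_2 field_simps)

lemma high_degree_bound:
  assumes "0 \<le> p" "6 * (real n * p) \<le> real K"
  shows "real n * (real (n choose K) * p ^ K) \<le> real n * (1 / 2) ^ K"
proof (cases "K = 0")
  case False
  have "real (n choose K) * p ^ K \<le> (exp 1 * real n / real K) ^ K * p ^ K"
    using assms by (intro mult_right_mono binomial_le_exp_power) auto
  also have "\<dots> = (exp 1 * (real n * p) / real K) ^ K"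
    by (simp add: power_mult_distrib power_divide mult_ac)
  also have "\<dots> \<le> (1 / 2) ^ K"
  proof (rule power_mono)
    have "exp 1 * (real n * p) \<le> 3 * (real n * p)"
      using exp_le assms(1) by (intro mult_right_mono) auto
    then show "exp 1 * (real n * p) / real K \<le> 1 / 2"
      using assms False by (simp add: field_simps)
  qed (use assms in auto)
  finally show ?thesis by (intro mult_left_mono) auto
qed simp

lemma large_independent_set_bound:
  assumes "0 \<le> p" "p \<le> 1" "0 < s"
    and le: "exp 1 * real n / real s * exp (- (p * (real s - 1) / 2)) \<le> x" and "x \<le> 1"
  shows "real (n choose s) * (1 - p) ^ (s choose 2) \<le> x"
proof -
  let ?y = "exp 1 * real n / real s * exp (- (p * (real s - 1) / 2))"
  have "(1 - p) ^ (s choose 2) \<le> exp (- p) ^ (s choose 2)"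
    using exp_ge_add_one_self[of "- p"] assms by (intro power_mono) auto
  also have "\<dots> = exp (- (p * (real s - 1) / 2)) ^ s"
  proof -
    show ?thesis by (simp add: exp_of_nat_mult[symmetric] real_choose_two mult_ac)
  qed
  finally have "real (n choose s) * (1 - p) ^ (s choose 2)
      \<le> (exp 1 * real n / real s) ^ s * exp (- (p * (real s - 1) / 2)) ^ s"
    using assms by (intro mult_mono binomial_le_exp_power) auto
  also have "\<dots> = ?y ^ s" by (simp only: power_mult_distrib)
  also have "?y ^ s \<le> ?y ^ 1"
  proof (rule power_decreasing)
    show "?y \<le> 1" using le assms(5) by linarith
  qed (use assms(3) in simp_all)
  also have "\<dots> \<le> x" using le by simp
  finally show ?thesis .
qed

lemma dense_subset_bound:
  fixes n s r :: nat and p L :: real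
  assumes p: "0 \<le> p" and s: "0 < s" "real s \<le> real n / L" and L: "0 < L"
    and r: "0 < r" "4 * (real n * p) / L \<le> real r"
  shows "real (n choose s) * (real ((s choose 2) choose (r * s)) * p ^ (r * s))
    \<le> (exp 1 * L * (1 / 2) ^ r) ^ s"
proof -
  have n: "0 < n" using s L by (cases "n = 0") auto
  have "real ((s choose 2) choose (r * s)) \<le> (exp 1 * real (s choose 2) / real (r * s)) ^ (r * s)"
    by (rule binomial_le_exp_power)
  also have "\<dots> \<le> (exp 1 * real s / (2 * real r)) ^ (r * s)"
  proof (rule power_mono)
    have "2 * real (s choose 2) \<le> real s * real s"
      by (simp add: real_choose_two field_simps)
    then show "exp 1 * real (s choose 2) / real (r * s) \<le> exp 1 * real s / (2 * real r)"
      using s r by (simp add: field_simps)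
  qed auto
  finally have "real (n choose s) * (real ((s choose 2) choose (r * s)) * p ^ (r * s))
     \<le> (exp 1 * real n / real s) ^ s * ((exp 1 * real s / (2 * real r)) ^ (r * s) * p ^ (r * s))"
    using p by (intro mult_mono binomial_le_exp_power) auto
  also have "\<dots> = (exp 1 * real n / real s * (exp 1 * real s * p / (2 * real r)) ^ r) ^ s"
    by (simp add: power_mult_distrib power_mult power_divide)
  also have "\<dots> \<le> (exp 1 * L * (1 / 2) ^ r) ^ s"
  proof (rule power_mono)
    let ?x = "real s * L / real n"
    have x: "0 < ?x" "?x \<le> 1" using s L n by (auto simp: field_simps)
    have "exp 1 * real s * p / (2 * real r) \<le> ?x * (1 / 2)"
    proof -
      have "exp 1 * real s * p / (2 * real r) \<le> 4 * real s * p / (2 * real r)"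
        using exp_le p by (intro divide_right_mono mult_right_mono) auto
      also have "\<dots> \<le> ?x * (1 / 2)"
        using r s L n mult_left_mono[OF r(2), of "real s * L"] by (simp add: field_simps)
      finally show ?thesis .
    qed
    then have "(exp 1 * real s * p / (2 * real r)) ^ r \<le> (?x * (1 / 2)) ^ r"
      using p by (intro power_mono) auto
    also have "\<dots> = ?x ^ r * (1 / 2) ^ r" by (rule power_mult_distrib)
    also have "\<dots> \<le> ?x ^ 1 * (1 / 2) ^ r"
      using x r by (intro mult_right_mono power_decreasing) auto
    finally have "exp 1 * real n / real s * (exp 1 * real s * p / (2 * real r)) ^ r
      \<le> exp 1 * real n / real s * (?x * (1 / 2) ^ r)"
      by (intro mult_left_mono) auto
    also have "\<dots> = exp 1 * L * (1 / 2) ^ r" using s n by simp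
    finally show "exp 1 * real n / real s * (exp 1 * real s * p / (2 * real r)) ^ r
      \<le> exp 1 * L * (1 / 2) ^ r" .
  qed (use p in auto)
  finally show ?thesis .
qed

lemma prob_small_dense_subset:
  fixes n r :: nat and p L q :: real
  defines "q \<equiv> exp 1 * L * (1 / 2) ^ r"
  assumes p: "0 \<le> p" "p \<le> 1" and L: "0 < L" and r: "0 < r" "4 * (real n * p) / L \<le> real r"
    and q: "q \<le> 1 / 2"
  shows "measure_pmf.prob (gnp n p)
     {E. \<exists>S. S \<subseteq> {..<n} \<and> S \<noteq> {} \<and> real (card S) \<le> real n / L \<and> r * card S \<le> card {e \<in> E. e \<subseteq> S}}
    \<le> 2 * q"
proof -
  let ?I = "{s. 0 < s \<and> real s \<le> real n / L}"
  let ?P = "\<lambda>s E. \<exists>S. S \<subseteq> {..<n} \<and> card S = s \<and> r * s \<le> card {e \<in> E. e \<subseteq> S}"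
  have fin: "finite ?I"
    by (rule finite_subset[of _ "{..nat \<lfloor>real n / L\<rfloor>}"]) (auto simp: le_nat_floor)
  have q0: "0 \<le> q" using L by (simp add: q_def)
  have "measure_pmf.prob (gnp n p)
      {E. \<exists>S. S \<subseteq> {..<n} \<and> S \<noteq> {} \<and> real (card S) \<le> real n / L \<and> r * card S \<le> card {e \<in> E. e \<subseteq> S}}
    \<le> measure_pmf.prob (gnp n p) (\<Union>s\<in>?I. {E. ?P s E})"
  proof (rule measure_pmf.finite_measure_mono)
    have "0 < card S" if "S \<subseteq> {..<n}" "S \<noteq> {}" for S :: "nat set"
      using that finite_subset by (auto simp: card_gt_0_iff)
    then show "{E. \<exists>S. S \<subseteq> {..<n} \<and> S \<noteq> {} \<and> real (card S) \<le> real n / L \<and> r * card S \<le> card {e \<in> E. e \<subseteq> S}}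
      \<subseteq> (\<Union>s\<in>?I. {E. ?P s E})" by blast
  qed simp
  also have "\<dots> \<le> (\<Sum>s\<in>?I. measure_pmf.prob (gnp n p) {E. ?P s E})"
    using fin by (intro measure_pmf.finite_measure_subadditive_finite) auto
  also have "\<dots> \<le> (\<Sum>s\<in>?I. q * (1 / 2) ^ (s - 1))"
  proof (rule sum_mono)
    fix s assume s: "s \<in> ?I"
    have "measure_pmf.prob (gnp n p) {E. ?P s E} \<le> q ^ s"
      using prob_dense_subset[OF p, of n s "r * s"] dense_subset_bound[OF p(1) _ _ L r, of s] s
      unfolding q_def by force
    also have "\<dots> = q * q ^ (s - 1)" using s by (cases s) auto
    also have "\<dots> \<le> q * (1 / 2) ^ (s - 1)" using q q0 by (intro mult_left_mono power_mono) auto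
    finally show "measure_pmf.prob (gnp n p) {E. ?P s E} \<le> q * (1 / 2) ^ (s - 1)" .
  qed
  also have "\<dots> = q * (\<Sum>s\<in>?I. (1 / 2) ^ (s - 1))" by (simp add: sum_distrib_left)
  also have "\<dots> \<le> q * 2"
  proof (rule mult_left_mono[OF _ q0])
    have "(\<Sum>s\<in>?I. (1 / 2 :: real) ^ (s - 1)) = (\<Sum>s\<in>(\<lambda>s. s - 1) ` ?I. (1 / 2) ^ s)"
      by (subst sum.reindex) (auto simp: inj_on_def)
    also have "\<dots> \<le> (\<Sum>s. (1 / 2) ^ s)"
      using fin by (intro sum_le_suminf summable_geometric) auto
    also have "\<dots> = 2" by (subst suminf_geometric) auto
    finally show "(\<Sum>s\<in>?I. (1 / 2 :: real) ^ (s - 1)) \<le> 2" .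
  qed
  finally show ?thesis using q0 by (simp add: mult.commute)
qed

subsection \<open>The two density ranges\<close>

lemma prob_chromatic_number_gt:
  fixes n k h r :: nat and p L q :: real
  defines "q \<equiv> exp 1 * L * (1 / 2) ^ r"
  assumes p: "0 \<le> p" "p \<le> 1" and L: "0 < L" and r: "0 < r" "4 * (real n * p) / L \<le> real r"
    and q: "q \<le> 1 / 2" and k: "0 < k" "n \<le> k * h" and n: "0 < n"
  shows "measure_pmf.prob (gnp n p) {E. l + h + 2 * r < chromatic_number {..<n} E}
    \<le> L * (1 - (1 - p) ^ k) ^ l + 2 * q"
proof -
  let ?F = "\<lambda>E. {v \<in> {..<n}. first_fit (l + h) k E n v = l + h}"
  let ?A = "{E. real n / L \<le> real (card (?F E))}"
  let ?B = "{E. \<exists>S. S \<subseteq> {..<n} \<and> S \<noteq> {} \<and> real (card S) \<le> real n / L \<and> r * card S \<le> card {e \<in> E. e \<subseteq> S}}"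
  have "measure_pmf.prob (gnp n p) {E. l + h + 2 * r < chromatic_number {..<n} E}
    \<le> measure_pmf.prob (gnp n p) {E. E \<in> ?A \<union> ?B}"
  proof (rule gnp_mono, rule ccontr)
    fix E assume E: "E \<subseteq> pairs {..<n}" and chi: "l + h + 2 * r < chromatic_number {..<n} E"
      and good: "E \<notin> ?A \<union> ?B"
    have "card {e \<in> E. e \<subseteq> S} < r * card S" if S: "S \<subseteq> ?F E" "S \<noteq> {}" for S
    proof -
      have "card S \<le> card (?F E)" using S by (intro card_mono) auto
      then have "real (card S) \<le> real n / L" using good by auto
      moreover have "S \<subseteq> {..<n}" using S(1) by auto
      ultimately show ?thesis using good S(2) by (metis (mono_tags, lifting) UnI2 mem_Collect_eq not_less)
    qed
    then have "\<exists>c. proper_colouring (?F E) E c \<and> c ` ?F E \<subseteq> {..<2 * r}"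
      by (intro sparse_imp_colourable[OF _ E]) simp_all
    then obtain c where c: "proper_colouring (?F E) E c" "c ` ?F E \<subseteq> {..<2 * r}" by blast
    have "first_fit (l + h) k E n ` ({..<n} - ?F E) \<subseteq> {..<l + h}"
      using first_fit_le[of _ n "l + h" k E] by (auto simp: nat_less_le)
    then have "chromatic_number {..<n} E \<le> l + h + 2 * r"
      by (rule chromatic_number_le_sum[OF first_fit_proper[OF E] _ c])
    then show False using chi by simp
  qed
  also have "\<dots> \<le> measure_pmf.prob (gnp n p) ?A + measure_pmf.prob (gnp n p) ?B"
    unfolding Collect_mem_eq by (intro measure_Un_le) simp_all
  also have "\<dots> \<le> L * (1 - (1 - p) ^ k) ^ l + 2 * q"
  proof (rule add_mono)
    have "measure_pmf.prob (gnp n p) ?A \<le> real (card {..<n}) * (1 - (1 - p) ^ k) ^ l / (real n / L)"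
      using L n prob_first_fit_fail[OF p _ k] by (intro prob_card_ge_le) auto
    then show "measure_pmf.prob (gnp n p) ?A \<le> L * (1 - (1 - p) ^ k) ^ l" using n by (simp add: mult.commute)
    show "measure_pmf.prob (gnp n p) ?B \<le> 2 * q"
      unfolding q_def using prob_small_dense_subset[OF p L r] q unfolding q_def by blast
  qed
  finally show ?thesis .
qed

lemma prob_no_rainbow_independent_set:
  assumes p: "0 \<le> p" "p \<le> 1"
  shows "measure_pmf.prob (gnp n p) {E. \<not> (\<forall>col. proper_colouring {..<n} E col \<longrightarrow>
      (\<exists>S. independent_set {..<n} E S \<and> rainbow col S \<and> n \<le> card S * (K + s)))}
    \<le> real n * (real (n choose K) * p ^ K) + real (n choose s) * (1 - p) ^ (s choose 2)"
proof -
  let ?A = "{E. \<exists>v<n. K \<le> card (neighbours {..<n} E v)}"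
  let ?B = "{E. \<exists>S. independent_set {..<n} E S \<and> s \<le> card S}"
  have "measure_pmf.prob (gnp n p) {E. \<not> (\<forall>col. proper_colouring {..<n} E col \<longrightarrow>
      (\<exists>S. independent_set {..<n} E S \<and> rainbow col S \<and> n \<le> card S * (K + s)))}
    \<le> measure_pmf.prob (gnp n p) {E. E \<in> ?A \<union> ?B}"
  proof (rule gnp_mono, rule ccontr)
    fix E assume E: "E \<subseteq> pairs {..<n}" and good: "E \<notin> ?A \<union> ?B"
      and bad: "\<not> (\<forall>col. proper_colouring {..<n} E col \<longrightarrow>
        (\<exists>S. independent_set {..<n} E S \<and> rainbow col S \<and> n \<le> card S * (K + s)))"
    have "card (neighbours {..<n} E v) \<le> K" if "v \<in> {..<n}" for v
      using good that by (force simp: not_le)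
    moreover have "card S \<le> s" if "independent_set {..<n} E S" for S
      using good that by (force simp: not_le)
    ultimately show False
      using bad exists_rainbow_independent_set[of "{..<n}" E, OF _ E, of _ K s] by auto
  qed
  also have "\<dots> \<le> measure_pmf.prob (gnp n p) ?A + measure_pmf.prob (gnp n p) ?B"
    unfolding Collect_mem_eq by (intro measure_Un_le) simp_all
  also have "\<dots> \<le> real n * (real (n choose K) * p ^ K) + real (n choose s) * (1 - p) ^ (s choose 2)"
    by (intro add_mono prob_high_degree prob_large_independent_set p)
  finally show ?thesis .
qed

lemma gnp_aasI:
  assumes "b \<longlonglongrightarrow> 0"
    and "eventually (\<lambda>n. measure_pmf.prob (gnp n (p n)) {E. \<not> P n E} \<le> b n) sequentially"
  shows "gnp_aas p P"
proof -
  have eq: "measure_pmf.prob (gnp n (p n)) {E. P n E}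
      = 1 - measure_pmf.prob (gnp n (p n)) {E. \<not> P n E}" for n
  proof -
    have "{E. P n E} = UNIV - {E. \<not> P n E}" by auto
    then show ?thesis using measure_pmf.prob_compl[of "{E. \<not> P n E}" "gnp n (p n)"] by simp
  qed
  have "(\<lambda>n. measure_pmf.prob (gnp n (p n)) {E. P n E}) \<longlonglongrightarrow> 1"
  proof (rule tendsto_sandwich)
    show "(\<lambda>n. 1 - b n) \<longlonglongrightarrow> 1" using tendsto_diff[OF tendsto_const assms(1), of 1] by simp
    show "eventually (\<lambda>n. 1 - b n \<le> measure_pmf.prob (gnp n (p n)) {E. P n E}) sequentially"
      using assms(2) by eventually_elim (simp add: eq)
  qed auto
  then show ?thesis by (simp add: gnp_aas_def)
qed

lemma power_half_le_powr: "x \<le> real K \<Longrightarrow> (1 / 2 :: real) ^ K \<le> (1 / 2) powr x"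
  by (simp add: powr_realpow[symmetric] powr_mono')

lemma exp_minus_le_one_minus:
  fixes p :: real
  assumes "0 \<le> p" "p \<le> 1 / 2"
  shows "exp (- (2 * p)) \<le> 1 - p"
proof -
  have "2 * p\<^sup>2 \<le> p" using mult_left_mono[OF assms(2,1)] by (simp add: power2_eq_square)
  then have "- (2 * p) \<le> ln (1 - p)"
    using ln_one_minus_pos_lower_bound[OF assms] by linarith
  then show ?thesis using assms by (subst (asm) ln_ge_iff) auto
qed

lemma prob_sparse_no_rainbow:
  fixes n :: nat and p :: real
  defines "d \<equiv> real n * p" and "L \<equiv> ln (real n * p)"
  assumes p: "0 < p" "p \<le> 1 / 8" and L: "1 \<le> L" and sparse: "6 * d \<le> sqrt (real n)"
    and small: "exp 1 * L * (1 / 2) powr (4 * exp L / L) \<le> 1 / 2" "3 * exp (- L) \<le> 1"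
  shows "measure_pmf.prob (gnp n p) {E. \<not> (\<forall>col. proper_colouring {..<n} E col \<longrightarrow>
      (\<exists>S. independent_set {..<n} E S \<and> rainbow col S \<and>
        real (card S) \<ge> 1 / 196 * real (chromatic_number {..<n} E)))}
    \<le> real n * (1 / 2) powr sqrt (real n) + 3 * exp (- L)
      + (L * exp (- (4 * exp (L / 2) / L)) + 2 * (exp 1 * L * (1 / 2) powr (4 * exp L / L)))"
proof -
  define k h r s K where "k = nat \<lfloor>L / (4 * p)\<rfloor>" and "h = nat \<lceil>real n / real k\<rceil>"
    and "r = nat \<lceil>4 * d / L\<rceil>" and "s = nat \<lceil>4 * L / p\<rceil>" and "K = nat \<lceil>sqrt (real n)\<rceil>"
  have n: "0 < n" using L unfolding L_def by (cases "n = 0") auto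
  have d: "0 < d" using n p by (simp add: d_def)
  have expL: "exp L = d" using d by (simp add: L_def d_def)
  have Ld: "L \<le> d" using exp_ge_add_one_self[of L] expL by linarith
  have p1: "0 \<le> p" "p \<le> 1" using p by auto
  have Lp: "1 \<le> L / (8 * p)" using p L by (simp add: field_simps)
  have k_le: "real k \<le> L / (4 * p)" unfolding k_def using Lp p L by (intro of_nat_floor) auto
  have k_ge: "L / (8 * p) \<le> real k"
  proof -
    have "L / (4 * p) < real k + 1" unfolding k_def by linarith
    moreover have "L / (4 * p) = 2 * (L / (8 * p))" by simp
    ultimately show ?thesis using Lp by linarith
  qed
  have k0: "0 < k" using k_ge Lp by (cases k) auto
  have h_ge: "real n / real k \<le> real h" unfolding h_def by (rule real_nat_ceiling_ge)
  have h_le: "real h \<le> 8 * d / L + 1"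
  proof -
    have "0 \<le> real n / real k" by simp
    then have "real h \<le> real n / real k + 1" unfolding h_def by linarith
    moreover have "real n / real k \<le> real n / (L / (8 * p))"
      using k_ge k0 p L by (intro divide_left_mono) auto
    ultimately show ?thesis by (simp add: d_def mult_ac)
  qed
  have r_ge: "4 * d / L \<le> real r" unfolding r_def by (rule real_nat_ceiling_ge)
  have r_le: "real r \<le> 4 * d / L + 1"
  proof -
    have "0 \<le> 4 * d / L" using d L by simp
    then show ?thesis unfolding r_def by linarith
  qed
  have r0: "0 < r" using r_ge d L by (cases r) (auto simp: field_simps)
  have s_ge: "4 * L / p \<le> real s" unfolding s_def by (rule real_nat_ceiling_ge)
  have s_le: "real s \<le> 4 * L / p + 1"
  proof -
    have "0 \<le> 4 * L / p" using p L by simp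
    then show ?thesis unfolding s_def by linarith
  qed
  have s0: "0 < s" using s_ge p L by (cases s) (auto simp: field_simps)
  have K_ge: "sqrt (real n) \<le> real K" unfolding K_def by (rule real_nat_ceiling_ge)
  have K_le: "real K \<le> sqrt (real n) + 1"
  proof -
    have "0 \<le> sqrt (real n)" by simp
    then show ?thesis unfolding K_def by linarith
  qed
  have sqrt_p: "sqrt (real n) \<le> 1 / p"
  proof -
    have "sqrt (real n) * (sqrt (real n) * p) \<le> sqrt (real n) * 1"
      using sparse d unfolding d_def by (simp flip: mult.assoc)
    then have "sqrt (real n) * p \<le> 1" using n by (subst (asm) mult_le_cancel_left_pos) auto
    then show ?thesis using p by (simp add: field_simps)
  qed
  have half: "exp 1 * L * (1 / 2) ^ r \<le> exp 1 * L * (1 / 2) powr (4 * exp L / L)"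
    using power_half_le_powr[of "4 * exp L / L" r] r_ge expL L by (intro mult_left_mono) auto
  have q_half: "exp 1 * L * (1 / 2) ^ r \<le> 1 / 2" using half small(1) by linarith
  have degree: "real n * (real (n choose K) * p ^ K) \<le> real n * (1 / 2) powr sqrt (real n)"
  proof -
    have "6 * (real n * p) \<le> real K" using sparse K_ge unfolding d_def by linarith
    then have "real n * (real (n choose K) * p ^ K) \<le> real n * (1 / 2) ^ K"
      using p1 by (intro high_degree_bound) auto
    also have "\<dots> \<le> real n * (1 / 2) powr sqrt (real n)"
      by (intro mult_left_mono power_half_le_powr K_ge) auto
    finally show ?thesis .
  qed
  have indep: "real (n choose s) * (1 - p) ^ (s choose 2) \<le> 3 * exp (- L)"
  proof (rule large_independent_set_bound[OF p1 s0 _ small(2)])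
    have "exp 1 * real n / real s \<le> d"
    proof -
      have "4 \<le> real s * p"
        using s_ge p L by (simp add: field_simps)
      then have "4 * real n \<le> (real s * p) * real n" by (intro mult_right_mono) auto
      moreover have "exp 1 * real n \<le> 4 * real n" using exp_le by (intro mult_right_mono) auto
      ultimately show ?thesis using s0 unfolding d_def by (simp add: field_simps)
    qed
    moreover have "exp (- (p * (real s - 1) / 2)) \<le> 3 * exp (- (2 * L))"
    proof -
      have "4 * L \<le> p * real s" using s_ge p by (simp add: field_simps)
      moreover have "p * (real s - 1) = p * real s - p" by (simp add: algebra_simps)
      ultimately have "- (p * (real s - 1) / 2) \<le> 1 + - (2 * L)" using p by linarith
      then have "exp (- (p * (real s - 1) / 2)) \<le> exp (1 + - (2 * L))" by simp
      also have "\<dots> = exp 1 * exp (- (2 * L))" by (rule exp_add)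
      also have "\<dots> \<le> 3 * exp (- (2 * L))" using exp_le by (intro mult_right_mono) auto
      finally show ?thesis .
    qed
    ultimately have "exp 1 * real n / real s * exp (- (p * (real s - 1) / 2)) \<le> d * (3 * exp (- (2 * L)))"
      using d by (intro mult_mono) auto
    also have "\<dots> = 3 * exp (L + - (2 * L))" unfolding exp_add expL by simp
    finally show "exp 1 * real n / real s * exp (- (p * (real s - 1) / 2)) \<le> 3 * exp (- L)" by simp
  qed
  have chi: "measure_pmf.prob (gnp n p) {E. h + h + 2 * r < chromatic_number {..<n} E}
    \<le> L * exp (- (4 * exp (L / 2) / L)) + 2 * (exp 1 * L * (1 / 2) powr (4 * exp L / L))"
  proof -
    have "real n \<le> real k * real h" using h_ge k0 by (simp add: field_simps)
    then have nk: "n \<le> k * h" by (metis of_nat_le_iff of_nat_mult)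
    have "measure_pmf.prob (gnp n p) {E. h + h + 2 * r < chromatic_number {..<n} E}
      \<le> L * (1 - (1 - p) ^ k) ^ h + 2 * (exp 1 * L * (1 / 2) ^ r)"
      using L r_ge n by (intro prob_chromatic_number_gt p1 r0 k0 nk q_half) (auto simp: d_def)
    also have "\<dots> \<le> L * exp (- (4 * exp (L / 2) / L)) + 2 * (exp 1 * L * (1 / 2) powr (4 * exp L / L))"
    proof (rule add_mono[OF mult_left_mono mult_left_mono[OF half]])
      have "exp (- (L / 2)) \<le> exp (- (2 * p)) ^ k"
      proof -
        have "2 * p * real k \<le> L / 2" using k_le p by (simp add: field_simps)
        then show ?thesis by (simp add: exp_of_nat_mult[symmetric] mult_ac)
      qed
      also have "\<dots> \<le> (1 - p) ^ k" using p by (intro power_mono exp_minus_le_one_minus) auto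
      finally have "(1 - (1 - p) ^ k) ^ h \<le> exp (- exp (- (L / 2))) ^ h"
        using exp_ge_add_one_self[of "- exp (- (L / 2))"] p1
        by (intro power_mono) (auto simp: power_le_one)
      also have "\<dots> = exp (- (real h * exp (- (L / 2))))" by (simp add: exp_of_nat_mult[symmetric])
      also have "\<dots> \<le> exp (- (4 * exp (L / 2) / L))"
      proof -
        have "4 * exp (L / 2) / L = 4 * d / L * exp (- (L / 2))"
          unfolding expL[symmetric] by (simp add: exp_add[symmetric])
        also have "4 * d / L \<le> real h"
        proof -
          have "4 * d / L = real n / (L / (4 * p))" by (simp add: d_def)
          also have "\<dots> \<le> real n / real k" using k_le k0 p L by (intro divide_left_mono) auto
          finally show ?thesis using h_ge by linarith
        qed
        finally show ?thesis by (simp add: mult_right_mono)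
      qed
      finally show "(1 - (1 - p) ^ k) ^ h \<le> exp (- (4 * exp (L / 2) / L))" .
    qed (use L in auto)
    finally show ?thesis .
  qed
  let ?R = "\<lambda>E col S. independent_set {..<n} E S \<and> rainbow col S"
  let ?A = "{E. \<not> (\<forall>col. proper_colouring {..<n} E col \<longrightarrow>
      (\<exists>S. independent_set {..<n} E S \<and> rainbow col S \<and> n \<le> card S * (K + s)))}"
  let ?B = "{E. h + h + 2 * r < chromatic_number {..<n} E}"
  have "{E. \<not> (\<forall>col. proper_colouring {..<n} E col \<longrightarrow>
      (\<exists>S. ?R E col S \<and> real (card S) \<ge> 1 / 196 * real (chromatic_number {..<n} E)))} \<subseteq> ?A \<union> ?B"
  proof -
    have "1 / 196 * real (chromatic_number {..<n} E) \<le> real (card S)"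
      if chi: "chromatic_number {..<n} E \<le> h + h + 2 * r" and S: "n \<le> card S * (K + s)" for E S
    proof -
      have "real (K + s) \<le> 7 * L / p"
      proof -
        have "1 / p \<le> L / p" "1 \<le> L / p" using p L by (auto simp: field_simps)
        then show ?thesis using K_le s_le sqrt_p by simp
      qed
      then have "real (card S) * real (K + s) \<le> real (card S) * (7 * L / p)" by (intro mult_left_mono) auto
      moreover have "real n \<le> real (card S) * real (K + s)" using S by (metis of_nat_le_iff of_nat_mult)
      ultimately have "real n \<le> real (card S) * (7 * L / p)" by linarith
      then have "d / L \<le> 7 * real (card S)" using p L by (simp add: d_def field_simps)
      moreover have "real (chromatic_number {..<n} E) \<le> 28 * (d / L)"
      proof -
        have "1 \<le> d / L" using Ld L by simp
        moreover have "real (chromatic_number {..<n} E) \<le> real (h + h + 2 * r)" using chi by linarith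
        ultimately show ?thesis using h_le r_le by simp
      qed
      ultimately show ?thesis by simp
    qed
    then show ?thesis by (fastforce simp: not_less)
  qed
  then have "measure_pmf.prob (gnp n p) {E. \<not> (\<forall>col. proper_colouring {..<n} E col \<longrightarrow>
      (\<exists>S. independent_set {..<n} E S \<and> rainbow col S \<and>
        real (card S) \<ge> 1 / 196 * real (chromatic_number {..<n} E)))}
    \<le> measure_pmf.prob (gnp n p) (?A \<union> ?B)"
    by (intro measure_pmf.finite_measure_mono) simp_all
  also have "\<dots> \<le> measure_pmf.prob (gnp n p) ?A + measure_pmf.prob (gnp n p) ?B"
    by (intro measure_Un_le) simp_all
  finally show ?thesis
    using prob_no_rainbow_independent_set[OF p1, of n K s] degree indep chi by linarith
qed

lemma prob_dense_no_rainbow: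
  fixes n :: nat and p :: real
  assumes p: "0 < p" "p \<le> 1" and np: "2 \<le> real n * p" and dense: "16 * ln (real n) \<le> real n * p\<^sup>2"
    and small: "9 * real n * exp (- (8 * ln (real n))) \<le> 1"
  shows "measure_pmf.prob (gnp n p) {E. \<not> (\<forall>col. proper_colouring {..<n} E col \<longrightarrow>
      (\<exists>S. independent_set {..<n} E S \<and> rainbow col S \<and> real (card S) \<ge> 1 / 8 * (1 / p)))}
    \<le> real n * exp (- (48 * ln (real n))) + 9 * real n * exp (- (8 * ln (real n)))"
proof -
  define s K where "s = nat \<lceil>real n * p\<rceil>" and "K = nat \<lceil>6 * (real n * p)\<rceil>"
  have p1: "0 \<le> p" "p \<le> 1" using p by auto
  have n: "0 < n" using np by (cases "n = 0") auto
  have s_ge: "real n * p \<le> real s" unfolding s_def by (rule real_nat_ceiling_ge)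
  have s_le: "real s \<le> real n * p + 1" unfolding s_def using np by linarith
  have K_ge: "6 * (real n * p) \<le> real K" unfolding K_def by (rule real_nat_ceiling_ge)
  have K_le: "real K \<le> 6 * (real n * p) + 1" unfolding K_def using np by linarith
  have s0: "0 < s" using s_ge np by (cases s) auto
  have np_ln: "16 * ln (real n) \<le> real n * p"
  proof -
    have "real n * p\<^sup>2 \<le> real n * p"
      using p by (intro mult_left_mono) (auto simp: power2_eq_square mult_left_le)
    then show ?thesis using dense by linarith
  qed
  have degree: "real n * (real (n choose K) * p ^ K) \<le> real n * exp (- (48 * ln (real n)))"
  proof -
    have "real n * (real (n choose K) * p ^ K) \<le> real n * (1 / 2) ^ K"
      using p1 K_ge by (intro high_degree_bound) auto
    also have "(1 / 2) ^ K \<le> (1 / 2 :: real) powr (96 * ln (real n))"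
      using np_ln K_ge by (intro power_half_le_powr) auto
    also have "(1 / 2 :: real) powr (96 * ln (real n)) \<le> exp (- (48 * ln (real n)))"
    proof -
      have "96 * ln (real n) * ln (1 / 2) \<le> 96 * ln (real n) * (1 / 2 - 1)"
        using n by (intro mult_left_mono ln_le_minus_one) auto
      then show ?thesis by (simp add: powr_def)
    qed
    finally show ?thesis by (simp add: mult_left_mono)
  qed
  have indep: "real (n choose s) * (1 - p) ^ (s choose 2) \<le> 9 * real n * exp (- (8 * ln (real n)))"
  proof (rule large_independent_set_bound[OF p1 s0 _ small])
    have "exp 1 * real n / real s \<le> 3 * real n / 1"
      using exp_le s0 by (intro frac_le mult_right_mono) auto
    moreover have "exp (- (p * (real s - 1) / 2)) \<le> 3 * exp (- (8 * ln (real n)))"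
    proof -
      have "p * (real n * p) \<le> p * real s" using s_ge p by (intro mult_left_mono) auto
      then have "16 * ln (real n) \<le> p * real s" using dense by (simp add: power2_eq_square mult_ac)
      moreover have "p * (real s - 1) = p * real s - p" by (simp add: algebra_simps)
      ultimately have "- (p * (real s - 1) / 2) \<le> 1 + - (8 * ln (real n))" using p by linarith
      then have "exp (- (p * (real s - 1) / 2)) \<le> exp (1 + - (8 * ln (real n)))" by simp
      also have "\<dots> = exp 1 * exp (- (8 * ln (real n)))" by (rule exp_add)
      also have "\<dots> \<le> 3 * exp (- (8 * ln (real n)))" using exp_le by (intro mult_right_mono) auto
      finally show ?thesis .
    qed
    ultimately have "exp 1 * real n / real s * exp (- (p * (real s - 1) / 2))
        \<le> 3 * real n / 1 * (3 * exp (- (8 * ln (real n))))"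
      by (intro mult_mono) auto
    then show "exp 1 * real n / real s * exp (- (p * (real s - 1) / 2))
        \<le> 9 * real n * exp (- (8 * ln (real n)))" by simp
  qed
  have "measure_pmf.prob (gnp n p) {E. \<not> (\<forall>col. proper_colouring {..<n} E col \<longrightarrow>
      (\<exists>S. independent_set {..<n} E S \<and> rainbow col S \<and> real (card S) \<ge> 1 / 8 * (1 / p)))}
    \<le> measure_pmf.prob (gnp n p) {E. \<not> (\<forall>col. proper_colouring {..<n} E col \<longrightarrow>
      (\<exists>S. independent_set {..<n} E S \<and> rainbow col S \<and> n \<le> card S * (K + s)))}"
  proof (rule measure_pmf.finite_measure_mono)
    have "1 / 8 * (1 / p) \<le> real (card S)" if S: "n \<le> card S * (K + s)" for S :: "nat set"
    proof -
      have "real n \<le> real (card S) * real (K + s)" using S by (metis of_nat_le_iff of_nat_mult)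
      also have "\<dots> \<le> real (card S) * (8 * (real n * p))"
        using K_le s_le np by (intro mult_left_mono) auto
      finally have "real n * 1 \<le> real n * (real (card S) * (8 * p))" by (simp add: mult_ac)
      then have "1 \<le> real (card S) * (8 * p)" using n by (subst (asm) mult_le_cancel_left_pos) auto
      then show ?thesis using p by (simp add: field_simps)
    qed
    then show "{E. \<not> (\<forall>col. proper_colouring {..<n} E col \<longrightarrow>
        (\<exists>S. independent_set {..<n} E S \<and> rainbow col S \<and> real (card S) \<ge> 1 / 8 * (1 / p)))}
      \<subseteq> {E. \<not> (\<forall>col. proper_colouring {..<n} E col \<longrightarrow>
        (\<exists>S. independent_set {..<n} E S \<and> rainbow col S \<and> n \<le> card S * (K + s)))}"
      by blast
  qed simp
  then show ?thesis
    using prob_no_rainbow_independent_set[OF p1, of n K s] degree indep by linarith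
qed

theorem theorem10:
  fixes p :: "nat \<Rightarrow> real"
  assumes p_prob: "\<And>n. 0 \<le> p n \<and> p n \<le> 1"
    and np_infinity: "filterlim (\<lambda>n. real n * p n) at_top sequentially"
    and p_zero: "p \<longlonglongrightarrow> 0"
  shows "(\<forall>c::real. 1 / 2 < c \<and> c \<le> 1 \<and> p \<in> o(\<lambda>n. real n powr (- c)) \<longrightarrow>
           (\<exists>\<delta>>0. gnp_aas p (\<lambda>n E.
              \<forall>col. proper_colouring {..<n} E col \<longrightarrow>
                (\<exists>S. independent_set {..<n} E S \<and> rainbow col S \<and>
                     real (card S) \<ge> \<delta> * real (chromatic_number {..<n} E)))))
       \<and> (p \<in> \<omega>(\<lambda>n. sqrt (ln (real n) / real n)) \<longrightarrow>
           (\<exists>\<delta>>0. gnp_aas p (\<lambda>n E.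
              \<forall>col. proper_colouring {..<n} E col \<longrightarrow>
                (\<exists>S. independent_set {..<n} E S \<and> rainbow col S \<and>
                     real (card S) \<ge> \<delta> * (1 / p n)))))"
proof (intro conjI allI impI)
  have p_pos: "eventually (\<lambda>n. 0 < p n) sequentially"
    using filterlim_at_top_dense[THEN iffD1, OF np_infinity, rule_format, of 0]
    by eventually_elim (simp add: zero_less_mult_iff)
  let ?L = "\<lambda>n. ln (real n * p n)"
  have L: "filterlim ?L at_top sequentially"
    using ln_at_top np_infinity by (rule filterlim_compose)
  {
    fix c :: real assume c: "1 / 2 < c \<and> c \<le> 1 \<and> p \<in> o(\<lambda>n. real n powr (- c))"
    let ?b = "\<lambda>n. real n * (1 / 2) powr sqrt (real n) + 3 * exp (- ?L n)
      + (?L n * exp (- (4 * exp (?L n / 2) / ?L n)) + 2 * (exp 1 * ?L n * (1 / 2) powr (4 * exp (?L n) / ?L n)))"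
    have q0: "(\<lambda>n. exp 1 * ?L n * (1 / 2) powr (4 * exp (?L n) / ?L n)) \<longlonglongrightarrow> 0"
      by (rule filterlim_compose[OF _ L]) real_asymp
    have e0: "(\<lambda>n. 3 * exp (- ?L n)) \<longlonglongrightarrow> 0"
      by (rule filterlim_compose[OF _ L]) real_asymp
    have "(\<lambda>n. ?L n * exp (- (4 * exp (?L n / 2) / ?L n))) \<longlonglongrightarrow> 0"
      by (rule filterlim_compose[OF _ L]) real_asymp
    moreover have "(\<lambda>n. real n * (1 / 2) powr sqrt (real n)) \<longlonglongrightarrow> 0" by real_asymp
    ultimately have b: "?b \<longlonglongrightarrow> 0" using q0 e0 by (auto intro!: tendsto_add_zero tendsto_mult_right_zero)
    have "eventually (\<lambda>n. 6 * (real n * p n) \<le> sqrt (real n)) sequentially"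
    proof -
      have "eventually (\<lambda>n. norm (p n) \<le> 1 / 6 * norm (real n powr (- c))) sequentially"
        using c by (intro landau_o.smallD) auto
      then show ?thesis using eventually_gt_at_top[of 0]
      proof eventually_elim
        case (elim n)
        have "real n powr (- c) \<le> real n powr (- (1 / 2))" using elim c by (intro powr_mono) auto
        then have "6 * p n \<le> real n powr (- (1 / 2))" using elim(1) by simp
        then have "real n * (6 * p n) \<le> real n * real n powr (- (1 / 2))" by (intro mult_left_mono) auto
        also have "\<dots> = real n powr (1 + - (1 / 2))" using elim(2) by (subst powr_add) auto
        also have "\<dots> = sqrt (real n)" by (simp add: powr_half_sqrt)
        finally show ?case by simp
      qed
    qed
    moreover have "eventually (\<lambda>n. p n < 1 / 8) sequentially"
      using p_zero by (rule order_tendstoD) simp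
    moreover have "eventually (\<lambda>n. 1 \<le> ?L n) sequentially"
      using L by (simp add: filterlim_at_top)
    moreover have "eventually (\<lambda>n. exp 1 * ?L n * (1 / 2) powr (4 * exp (?L n) / ?L n) < 1 / 2) sequentially"
      using q0 by (rule order_tendstoD) simp
    moreover have "eventually (\<lambda>n. 3 * exp (- ?L n) < 1) sequentially"
      using e0 by (rule order_tendstoD) simp
    ultimately have "eventually (\<lambda>n. measure_pmf.prob (gnp n (p n)) {E. \<not> (\<forall>col. proper_colouring {..<n} E col \<longrightarrow>
      (\<exists>S. independent_set {..<n} E S \<and> rainbow col S \<and>
        real (card S) \<ge> 1 / 196 * real (chromatic_number {..<n} E)))} \<le> ?b n) sequentially"
      using p_pos
    proof eventually_elim
      case (elim n)
      then show ?case by (intro prob_sparse_no_rainbow) auto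
    qed
    with b show "\<exists>\<delta>>0. gnp_aas p (\<lambda>n E. \<forall>col. proper_colouring {..<n} E col \<longrightarrow>
                (\<exists>S. independent_set {..<n} E S \<and> rainbow col S \<and>
                     real (card S) \<ge> \<delta> * real (chromatic_number {..<n} E)))"
      by (intro exI[of _ "1 / 196"] conjI gnp_aasI[of ?b]) simp_all
  next
    assume om: "p \<in> \<omega>(\<lambda>n. sqrt (ln (real n) / real n))"
    let ?e = "\<lambda>n::nat. 9 * real n * exp (- (8 * ln (real n)))"
    let ?b = "\<lambda>n. real n * exp (- (48 * ln (real n))) + ?e n"
    have e0: "?e \<longlonglongrightarrow> 0" by real_asymp
    have b: "?b \<longlonglongrightarrow> 0" by real_asymp
    have "eventually (\<lambda>n. 16 * ln (real n) \<le> real n * (p n)\<^sup>2) sequentially"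
    proof -
      have "eventually (\<lambda>n. norm (p n) \<ge> 4 * norm (sqrt (ln (real n) / real n))) sequentially"
        using om by (intro landau_omega.smallD) auto
      then show ?thesis using eventually_gt_at_top[of 0]
      proof eventually_elim
        case (elim n)
        have ln0: "0 \<le> ln (real n)" using elim(2) by simp
        have "4 * sqrt (ln (real n) / real n) \<le> p n" using elim p_prob[of n] ln0 by simp
        then have "(4 * sqrt (ln (real n) / real n))\<^sup>2 \<le> (p n)\<^sup>2" using ln0 by (intro power_mono) auto
        then have "16 * (ln (real n) / real n) \<le> (p n)\<^sup>2" using ln0 by (simp add: power_mult_distrib)
        then show ?case using elim(2) by (simp add: field_simps)
      qed
    qed
    moreover have "eventually (\<lambda>n. 2 \<le> real n * p n) sequentially"
      using np_infinity by (simp add: filterlim_at_top)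
    moreover have "eventually (\<lambda>n. ?e n < 1) sequentially"
      using e0 by (rule order_tendstoD) simp
    ultimately have "eventually (\<lambda>n. measure_pmf.prob (gnp n (p n)) {E. \<not> (\<forall>col. proper_colouring {..<n} E col \<longrightarrow>
      (\<exists>S. independent_set {..<n} E S \<and> rainbow col S \<and> real (card S) \<ge> 1 / 8 * (1 / p n)))} \<le> ?b n) sequentially"
      using p_pos
    proof eventually_elim
      case (elim n)
      then show ?case using p_prob[of n] by (intro prob_dense_no_rainbow) auto
    qed
    with b show "\<exists>\<delta>>0. gnp_aas p (\<lambda>n E. \<forall>col. proper_colouring {..<n} E col \<longrightarrow>
                (\<exists>S. independent_set {..<n} E S \<and> rainbow col S \<and> real (card S) \<ge> \<delta> * (1 / p n)))"
      by (intro exI[of _ "1 / 8"] conjI gnp_aasI[of ?b]) simp_all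
  }
qed

end
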